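(* If $\lambda\in\rho(A_0)$, then the restriction $R|_{\ker(\lambda-A)}$ has an inverse $$D_\lambda^{A,R}:\partial X\to\ker(\lambda-A).$$ Moreover, $D_\lambda^{A,R}$ is bounded from $\partial X$ to $Z$ for every Banach space $Z$ satisfying $D(A^\infty)\subset Z\hookrightarrow Y$.
   Context: Standing assumptions: $X$, $Y$, $\partial X$ are Banach spaces ($\partial X$ is just the name of a third Banach space) with $Y\hookrightarrow X$; here $\hookrightarrow$ denotes continuous embedding. $A:D(A)\to X$ is linear with $D(A)\subset Y$; $R:D(A)\to\partial X$ is linear and surjective; the operator $\binom{A}{R}:D(A)\subset Y\to X\times\partial X$, $u\mapsto(Au,Ru)$, is closed; the restriction $A_0:=A|_{\ker R}$ generates a cosine operator function with associated phase space $Y\times X$ (i.e. the operator matrix $\begin{pmatrix} 0 & I_Y \\ A_0 & 0 \end{pmatrix}$ with domain $D(A_0)\times Y$ generates a strongly continuous group on $Y\times X$). $D(A^\infty)=\bigcap_{k\ge1}D(A^k)$. The operator $D_\lambda^{A,R}$ is called the Dirichlet operator associated with $A$ and $R$. *)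

theory Defs
  imports "HOL-Analysis.Analysis"
begin

(* Scalars: a real_normed_field is, up to isomorphism, either the reals or the complex numbers,
   so quantifying over 'k covers real and complex Banach spaces at once.  The norm identity forces
   scale (of_real r) = scaleR r, so scale extends the real vector space structure of 'v. *)
locale banach_over = vector_space scale
  for scale :: "'k::real_normed_field \<Rightarrow> 'v::banach \<Rightarrow> 'v" +
  assumes norm_scale: "norm (scale a x) = norm a * norm x"

definition scale_prod :: "('k \<Rightarrow> 'v \<Rightarrow> 'v) \<Rightarrow> ('k \<Rightarrow> 'w \<Rightarrow> 'w) \<Rightarrow> 'k \<Rightarrow> 'v \<times> 'w \<Rightarrow> 'v \<times> 'w"
  where "scale_prod s1 s2 a = map_prod (s1 a) (s2 a)"

definition bounded_operator ::
  "('k::real_normed_field \<Rightarrow> 'v::banach \<Rightarrow> 'v) \<Rightarrow> ('k \<Rightarrow> 'w::banach \<Rightarrow> 'w) \<Rightarrow> ('v \<Rightarrow> 'w) \<Rightarrow> bool"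
  where "bounded_operator s1 s2 f \<longleftrightarrow> Vector_Spaces.linear s1 s2 f \<and> bounded_linear f"

(* A continuously embedded space is a Banach space type together with its inclusion map. *)
definition continuous_embedding ::
  "('k::real_normed_field \<Rightarrow> 'v::banach \<Rightarrow> 'v) \<Rightarrow> ('k \<Rightarrow> 'w::banach \<Rightarrow> 'w) \<Rightarrow> ('v \<Rightarrow> 'w) \<Rightarrow> bool"
  where "continuous_embedding s1 s2 e \<longleftrightarrow> bounded_operator s1 s2 e \<and> inj e"

(* An unbounded operator is a pair of a domain D and a function f;
   the values of f outside D are irrelevant. *)
definition linear_operator ::
  "('k::real_normed_field \<Rightarrow> 'v::banach \<Rightarrow> 'v) \<Rightarrow> ('k \<Rightarrow> 'w::banach \<Rightarrow> 'w) \<Rightarrow>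
   'v set \<Rightarrow> ('v \<Rightarrow> 'w) \<Rightarrow> bool"
  where "linear_operator s1 s2 D f \<longleftrightarrow>
    module.subspace s1 D \<and>
    (\<forall>u\<in>D. \<forall>v\<in>D. f (u + v) = f u + f v) \<and>
    (\<forall>a. \<forall>u\<in>D. f (s1 a u) = s2 a (f u))"

definition operator_graph :: "'v set \<Rightarrow> ('v \<Rightarrow> 'w) \<Rightarrow> ('v \<times> 'w) set"
  where "operator_graph D f = (\<lambda>u. (u, f u)) ` D"

definition closed_operator :: "'v::banach set \<Rightarrow> ('v \<Rightarrow> 'w::banach) \<Rightarrow> bool"
  where "closed_operator D f \<longleftrightarrow> closed (operator_graph D f)"

definition operator_kernel :: "'v set \<Rightarrow> ('v \<Rightarrow> 'w::zero) \<Rightarrow> 'v set"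
  where "operator_kernel D f = {u \<in> D. f u = 0}"

primrec power_domain :: "'v set \<Rightarrow> ('v \<Rightarrow> 'v) \<Rightarrow> nat \<Rightarrow> 'v set"
  where
    "power_domain D f 0 = UNIV"
  | "power_domain D f (Suc k) = {u \<in> D. f u \<in> power_domain D f k}"

definition smooth_domain :: "'v set \<Rightarrow> ('v \<Rightarrow> 'v) \<Rightarrow> 'v set"
  where "smooth_domain D f = (\<Inter>k\<in>{1..}. power_domain D f k)"

definition resolvent_set ::
  "('k::real_normed_field \<Rightarrow> 'v::banach \<Rightarrow> 'v) \<Rightarrow> 'v set \<Rightarrow> ('v \<Rightarrow> 'v) \<Rightarrow> 'k set"
  where "resolvent_set s D f =
    {\<mu>. bij_betw (\<lambda>u. s \<mu> u - f u) D UNIV \<and>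
        bounded_operator s s (the_inv_into D (\<lambda>u. s \<mu> u - f u))}"

definition strongly_continuous_group ::
  "('k::real_normed_field \<Rightarrow> 'v::banach \<Rightarrow> 'v) \<Rightarrow> (real \<Rightarrow> 'v \<Rightarrow> 'v) \<Rightarrow> bool"
  where "strongly_continuous_group s T \<longleftrightarrow>
    (\<forall>t. bounded_operator s s (T t)) \<and>
    T 0 = id \<and>
    (\<forall>t r. T (t + r) = T t \<circ> T r) \<and>
    (\<forall>x. continuous_on UNIV (\<lambda>t. T t x))"

definition group_generator :: "(real \<Rightarrow> 'v::banach \<Rightarrow> 'v) \<Rightarrow> ('v \<times> 'v) set"
  where "group_generator T = {(x, y). ((\<lambda>h. (T h x - x) /\<^sub>R h) \<longlongrightarrow> y) (at 0)}"

definition generates_group ::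
  "('k::real_normed_field \<Rightarrow> 'v::banach \<Rightarrow> 'v) \<Rightarrow> 'v set \<Rightarrow> ('v \<Rightarrow> 'v) \<Rightarrow> bool"
  where "generates_group s D f \<longleftrightarrow>
    (\<exists>T. strongly_continuous_group s T \<and> group_generator T = operator_graph D f)"

(* The operator (D, f) in X generates a cosine operator function with phase space Y \<times> X, where
   j is the inclusion of Y into X: the operator matrix (0, I_Y; f, 0) with domain D \<times> Y generates
   a group on Y \<times> X.  D and Y are regarded here as subsets of Y and X by means of j. *)
definition generates_cosine ::
  "('k::real_normed_field \<Rightarrow> 'y::banach \<Rightarrow> 'y) \<Rightarrow> ('k \<Rightarrow> 'x::banach \<Rightarrow> 'x) \<Rightarrow> ('y \<Rightarrow> 'x) \<Rightarrow>
   'x set \<Rightarrow> ('x \<Rightarrow> 'x) \<Rightarrow> bool"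
  where "generates_cosine sY sX j D f \<longleftrightarrow>
    generates_group (scale_prod sY sX) ((j -` D) \<times> range j) (\<lambda>(u, v). (inv j v, f (j u)))"

definition dirichlet_operator ::
  "('k::real_normed_field \<Rightarrow> 'x::banach \<Rightarrow> 'x) \<Rightarrow> 'x set \<Rightarrow> ('x \<Rightarrow> 'x) \<Rightarrow> ('x \<Rightarrow> 'b::banach) \<Rightarrow>
   'k \<Rightarrow> 'b \<Rightarrow> 'x"
  where "dirichlet_operator sX DA A R lam =
    the_inv_into (operator_kernel DA (\<lambda>u. sX lam u - A u)) R"

end

theory Submission
  imports Defs
begin

text \<open>
  Write \<open>B = \<lambda> - A\<close> on the domain of \<open>A\<close>. The resolvent hypothesis says that \<open>B\<close> maps \<open>ker R\<close>
  bijectively onto \<open>X\<close>, and \<open>R\<close> is onto. The roles of \<open>B\<close> and \<open>R\<close> can then be exchanged: the domain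
  is the direct sum \<open>ker R \<oplus> ker B\<close>, so \<open>R\<close> maps \<open>ker B\<close> bijectively onto \<open>\<partial>X\<close>
  (\<open>kernel_bijection_exchange\<close>). Its inverse is the Dirichlet operator.

  For the boundedness into \<open>Z\<close>, note that \<open>A\<close> acts on \<open>ker B\<close> as multiplication by \<open>\<lambda>\<close>, so \<open>ker B\<close>
  lies in every \<open>D(A\<^sup>k)\<close> and hence in \<open>Z\<close>. The Dirichlet operator thus factors through \<open>Z\<close>.
  Its graph in \<open>\<partial>X \<times> Z\<close> is closed: if \<open>x\<^sub>n \<rightarrow> x\<close> and the images \<open>u\<^sub>n\<close> converge to \<open>u\<close> in \<open>Z\<close>, then
  \<open>u\<^sub>n \<rightarrow> u\<close> also in \<open>Y\<close> and in \<open>X\<close>, so \<open>A u\<^sub>n = \<lambda> u\<^sub>n \<rightarrow> \<lambda> u\<close> and \<open>R u\<^sub>n = x\<^sub>n \<rightarrow> x\<close>; closedness of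
  \<open>u \<mapsto> (A u, R u)\<close> gives \<open>A u = \<lambda> u\<close> and \<open>R u = x\<close>. The closed graph theorem finishes the proof.
  It is proved here from the Baire category theorem.
\<close>

section \<open>The closed graph theorem\<close>

text \<open>
  The sets \<open>{v. norm (f v) \<le> n}\<close> cover the space, so by Baire the closure of one of them has
  interior points. Each of these sets is convex and symmetric, so its closure is then a
  neighbourhood of 0, and scaling turns this into an approximation of every point with a uniform
  bound.
\<close>

lemma linear_approximable_with_bounded_image:
  fixes f :: "'a::banach \<Rightarrow> 'b::real_normed_vector"
  assumes "linear f"
  obtains C where "C \<ge> 0"
    "\<And>x e. e > 0 \<Longrightarrow> \<exists>v. norm (f v) \<le> C * norm x \<and> norm (x - v) < e"
proof -
  interpret f: linear f by fact
  define V where "V n = {v. norm (f v) \<le> real n}" for n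
  have cover: "(\<Union>n. closure (V n)) = UNIV"
  proof -
    have "x \<in> (\<Union>n. closure (V n))" for x
    proof -
      obtain n where "norm (f x) \<le> real n" using real_arch_simple by blast
      then have "x \<in> V n" by (simp add: V_def)
      then show ?thesis using closure_subset by blast
    qed
    then show ?thesis by blast
  qed
  have "\<exists>n. interior (closure (V n)) \<noteq> {}"
  proof (rule ccontr)
    assume "\<not> (\<exists>n. interior (closure (V n)) \<noteq> {})"
    then have "(euclidean :: 'a topology) interior_of \<Union>(range (\<lambda>n. closure (V n))) = {}"
      by (intro Baire_category_alt) (auto simp: completely_metrizable_space_euclidean)
    then show False by (simp add: cover)
  qed
  then obtain n x0 where "x0 \<in> interior (closure (V n))" by blast
  then obtain r where r: "r > 0" "ball x0 r \<subseteq> closure (V n)"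
    by (meson mem_interior)
  have near: "\<exists>v. norm (f v) \<le> real n \<and> norm (y - v) < e" if y: "norm y < r" and e: "e > 0" for y e
  proof -
    have "x0 + y \<in> closure (V n)" "x0 - y \<in> closure (V n)"
      using r y by (auto simp: dist_norm subset_iff)
    then obtain a b where a: "a \<in> V n" "dist a (x0 + y) < e" and b: "b \<in> V n" "dist b (x0 - y) < e"
      using e unfolding closure_approachable by blast
    \<comment> \<open>Half the difference of approximations to \<open>x0 + y\<close> and \<open>x0 - y\<close> approximates \<open>y\<close>.\<close>
    define v where "v = (1/2) *\<^sub>R (a - b)"
    have "f v = (1/2) *\<^sub>R (f a - f b)" by (simp add: v_def f.scaleR f.diff)
    moreover have "norm (f a - f b) \<le> 2 * real n"
      using norm_triangle_ineq4[of "f a" "f b"] a(1) b(1) by (simp add: V_def)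
    ultimately have "norm (f v) \<le> real n" by simp
    moreover have "norm (y - v) < e"
    proof -
      have "2 *\<^sub>R (y - v) = (b - (x0 - y)) - (a - (x0 + y))"
        by (simp add: v_def algebra_simps scaleR_2)
      then have "2 * norm (y - v) = norm ((b - (x0 - y)) - (a - (x0 + y)))"
        by (metis abs_numeral norm_scaleR)
      also have "\<dots> < 2 * e"
        using norm_triangle_ineq4[of "b - (x0 - y)" "a - (x0 + y)"] a(2) b(2)
        by (simp add: dist_norm)
      finally show ?thesis by simp
    qed
    ultimately show ?thesis by blast
  qed
  show ?thesis
  proof
    show "0 \<le> 2 * real n / r" using r by simp
    fix x :: 'a and e :: real
    assume e: "e > 0"
    show "\<exists>v. norm (f v) \<le> 2 * real n / r * norm x \<and> norm (x - v) < e"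
    proof (cases "x = 0")
      case True
      then show ?thesis using e by (intro exI[of _ 0]) (simp add: f.zero)
    next
      case False
      define c where "c = r / (2 * norm x)"
      have c: "c > 0" using False r by (simp add: c_def)
      have "norm (c *\<^sub>R x) < r" using False r by (simp add: c_def)
      then obtain w where w: "norm (f w) \<le> real n" "norm (c *\<^sub>R x - w) < c * e"
        using near[of "c *\<^sub>R x" "c * e"] c e by auto
      define v where "v = inverse c *\<^sub>R w"
      have "norm (f v) = norm (f w) / c"
        using c by (simp add: v_def f.scaleR divide_inverse mult.commute)
      also have "\<dots> \<le> real n / c" using w c by (simp add: divide_right_mono)
      also have "\<dots> = 2 * real n / r * norm x" using False r by (simp add: c_def)
      finally have "norm (f v) \<le> 2 * real n / r * norm x" .
      moreover have "c * norm (x - v) = norm (c *\<^sub>R x - w)"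
      proof -
        have "c *\<^sub>R (x - v) = c *\<^sub>R x - w" using c by (simp add: v_def algebra_simps)
        then show ?thesis using c by (metis abs_of_pos norm_scaleR)
      qed
      then have "norm (x - v) < e" using w(2) mult_less_cancel_left_pos[OF c] by metis
      ultimately show ?thesis by blast
    qed
  qed
qed

text \<open>
  Successive approximation: \<open>x\<close> is the sum of vectors \<open>v\<^sub>k\<close> whose images are bounded by
  \<open>C * norm x / 2 ^ k\<close>. The sum of the images exists by completeness of the target, and the closed
  graph identifies it with \<open>f x\<close>.
\<close>

theorem closed_graph_theorem:
  fixes f :: "'a::banach \<Rightarrow> 'b::banach"
  assumes "linear f" and graph: "closed (range (\<lambda>x. (x, f x)))"
  shows "bounded_linear f"
proof -
  interpret f: linear f by fact
  obtain C where C: "C \<ge> 0"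
    "\<And>x e. e > 0 \<Longrightarrow> \<exists>v. norm (f v) \<le> C * norm x \<and> norm (x - v) < e"
    using linear_approximable_with_bounded_image[OF assms(1)] by metis
  have "\<exists>v. norm (f v) \<le> C * norm x \<and> norm (x - v) \<le> norm x / 2" for x
  proof (cases "x = 0")
    case True
    then show ?thesis by (intro exI[of _ 0]) (simp add: f.zero)
  next
    case False
    then show ?thesis using C(2)[of "norm x / 2" x] by (meson half_gt_zero less_imp_le zero_less_norm_iff)
  qed
  then obtain g where g: "\<And>x. norm (f (g x)) \<le> C * norm x" "\<And>x. norm (x - g x) \<le> norm x / 2"
    by metis
  have "norm (f x) \<le> norm x * (2 * C)" for x
  proof -
    \<comment> \<open>\<open>s k\<close> is what is left of \<open>x\<close> after \<open>k\<close> approximation steps.\<close>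
    define s where "s k = ((\<lambda>y. y - g y) ^^ k) x" for k
    have s_Suc: "s (Suc k) = s k - g (s k)" for k by (simp add: s_def)
    have s_bound: "norm (s k) \<le> norm x * (1/2) ^ k" for k
    proof (induction k)
      case 0
      then show ?case by (simp add: s_def)
    next
      case (Suc k)
      then show ?case using g(2)[of "s k"] by (simp add: s_Suc)
    qed
    have image_bound: "norm (f (g (s k))) \<le> C * norm x * (1/2) ^ k" for k
      using g(1)[of "s k"] mult_left_mono[OF s_bound[of k] C(1)] by (simp add: mult.assoc)
    have geometric: "(\<lambda>k. C * norm x * (1/2) ^ k) sums (C * norm x * 2)"
      using sums_mult[OF geometric_sums[of "1/2::real"], of "C * norm x"] by simp
    have summable: "summable (\<lambda>k. f (g (s k)))"
      by (rule summable_comparison_test'[OF sums_summable[OF geometric]]) (use image_bound in auto)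
    define z where "z = (\<Sum>k. f (g (s k)))"
    have partial: "f (x - s k) = (\<Sum>i<k. f (g (s i)))" for k
    proof (induction k)
      case 0
      then show ?case by (simp add: s_def f.zero)
    next
      case (Suc k)
      then show ?case by (simp add: s_Suc f.diff f.add flip: Suc)
    qed
    have "s \<longlonglongrightarrow> 0"
    proof (rule Lim_null_comparison)
      show "\<forall>\<^sub>F k in sequentially. norm (s k) \<le> norm x * (1/2) ^ k" using s_bound by simp
      show "(\<lambda>k. norm x * (1/2) ^ k) \<longlonglongrightarrow> 0"
        by (intro tendsto_mult_right_zero LIMSEQ_realpow_zero) auto
    qed
    then have "(\<lambda>k. x - s k) \<longlonglongrightarrow> x" using tendsto_diff[OF tendsto_const[of x]] by fastforce
    moreover have "(\<lambda>k. f (x - s k)) \<longlonglongrightarrow> z"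
      using summable_LIMSEQ[OF summable] by (simp add: partial z_def)
    ultimately have "(\<lambda>k. (x - s k, f (x - s k))) \<longlonglongrightarrow> (x, z)" by (rule tendsto_Pair)
    then have "(x, z) \<in> range (\<lambda>x. (x, f x))"
      by (rule closed_sequentially[OF graph, rotated]) auto
    then have "f x = z" by auto
    moreover have "norm z \<le> C * norm x * 2"
      unfolding z_def sums_unique[OF geometric]
      by (intro norm_suminf_le sums_summable[OF geometric] image_bound)
    ultimately show ?thesis by (simp add: mult_ac)
  qed
  then show ?thesis by unfold_locales blast
qed

section \<open>Operators between Banach spaces over the scalar field\<close>

text \<open>
  The defect \<open>d t = scale (of_real t) x - t *\<^sub>R x\<close> is additive in \<open>t\<close> and vanishes at 1, so it is
  periodic with period 1. By the norm identity it is therefore bounded, and a bounded additive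
  function is zero.
\<close>

lemma (in banach_over) scale_of_real: "scale (of_real r) x = r *\<^sub>R x"
proof -
  define d where "d t = scale (of_real t) x - t *\<^sub>R x" for t
  have d_add: "d (t + u) = d t + d u" for t u
    by (simp add: d_def scale_left_distrib scaleR_left_distrib)
  interpret d: additive d by standard (rule d_add)
  have d_nat: "d (real n * t) = real n *\<^sub>R d t" for n t
    by (induction n) (simp_all add: d.zero d_add scaleR_left_distrib ring_distribs)
  have d_int: "d (of_int m) = 0" for m :: int
  proof -
    have "d (real n) = 0" for n using d_nat[of n 1] by (simp add: d_def)
    then show ?thesis by (cases m rule: int_cases2) (simp_all add: d.minus)
  qed
  have bound: "norm (d t) \<le> 2 * norm x" for t
  proof -
    have "d t = d (frac t)"
      using d_add[of "of_int \<lfloor>t\<rfloor>" "frac t"] d_int by (simp add: frac_def)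
    moreover have "norm (d (frac t)) \<le> frac t * norm x + frac t * norm x"
      unfolding d_def using norm_triangle_ineq4 by (rule order_trans) (simp add: norm_scale)
    moreover have "frac t * norm x \<le> 1 * norm x"
      by (intro mult_right_mono less_imp_le[OF frac_lt_1]) auto
    ultimately show ?thesis by simp
  qed
  have "norm (d r) = 0"
  proof (rule ccontr)
    assume "norm (d r) \<noteq> 0"
    then obtain n where "2 * norm x < real n * norm (d r)"
      using reals_Archimedean3[of "norm (d r)"] by auto
    then show False using bound[of "real n * r"] by (simp add: d_nat)
  qed
  then show ?thesis by (simp add: d_def)
qed

lemma (in banach_over) tendsto_scale:
  assumes "(f \<longlongrightarrow> l) F"
  shows "((\<lambda>x. scale a (f x)) \<longlongrightarrow> scale a l) F"
proof (rule LIM_zero_cancel, rule tendsto_norm_zero_cancel)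
  show "((\<lambda>x. norm (scale a (f x) - scale a l)) \<longlongrightarrow> 0) F"
    using tendsto_mult_right_zero[OF tendsto_norm_zero[OF LIM_zero[OF assms]], of "norm a"]
    by (simp add: norm_scale flip: scale_right_diff_distrib)
qed

lemma bounded_operator_if_closed_graph:
  assumes s1: "banach_over s1" and s2: "banach_over s2"
    and lin: "Vector_Spaces.linear s1 s2 f" and graph: "closed (range (\<lambda>x. (x, f x)))"
  shows "bounded_operator s1 s2 f"
proof -
  have "linear f"
  proof (rule linearI)
    show "f (x + y) = f x + f y" for x y
      using lin by (simp add: Vector_Spaces.linear_iff)
    show "f (r *\<^sub>R x) = r *\<^sub>R f x" for r x
      using lin banach_over.scale_of_real[OF s1, of r x] banach_over.scale_of_real[OF s2, of r "f x"]
      unfolding Vector_Spaces.linear_iff by metis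
  qed
  then show ?thesis
    using lin closed_graph_theorem[OF _ graph] by (simp add: bounded_operator_def)
qed

lemma linear_operatorD:
  assumes "banach_over s1" and "linear_operator s1 s2 D f"
  shows "0 \<in> D" "u \<in> D \<Longrightarrow> v \<in> D \<Longrightarrow> u + v \<in> D" "u \<in> D \<Longrightarrow> v \<in> D \<Longrightarrow> u - v \<in> D"
    "u \<in> D \<Longrightarrow> s1 a u \<in> D"
    "u \<in> D \<Longrightarrow> v \<in> D \<Longrightarrow> f (u + v) = f u + f v" "u \<in> D \<Longrightarrow> v \<in> D \<Longrightarrow> f (u - v) = f u - f v"
    "u \<in> D \<Longrightarrow> f (s1 a u) = s2 a (f u)" "f 0 = 0"
proof -
  interpret s1: banach_over s1 by fact
  have sub: "s1.subspace D" and add: "\<And>u v. u \<in> D \<Longrightarrow> v \<in> D \<Longrightarrow> f (u + v) = f u + f v"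
    and scale: "\<And>a u. u \<in> D \<Longrightarrow> f (s1 a u) = s2 a (f u)"
    using assms(2) by (auto simp: linear_operator_def)
  show zero: "0 \<in> D" and "u \<in> D \<Longrightarrow> v \<in> D \<Longrightarrow> u + v \<in> D" and "u \<in> D \<Longrightarrow> s1 a u \<in> D"
    using sub by (auto intro: s1.subspace_0 s1.subspace_add s1.subspace_scale)
  have diff: "u - v \<in> D" if "u \<in> D" "v \<in> D" for u v
    using sub that by (rule s1.subspace_diff)
  then show "u \<in> D \<Longrightarrow> v \<in> D \<Longrightarrow> u - v \<in> D" .
  show "u \<in> D \<Longrightarrow> v \<in> D \<Longrightarrow> f (u + v) = f u + f v" by (rule add)
  show "u \<in> D \<Longrightarrow> v \<in> D \<Longrightarrow> f (u - v) = f u - f v" using add[OF diff, of u v v] by simp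
  show "u \<in> D \<Longrightarrow> f (s1 a u) = s2 a (f u)" by (rule scale)
  show "f 0 = 0" using add[OF zero zero] by simp
qed

lemma linear_operator_shifted:
  assumes "banach_over s" and "linear_operator s s D f"
  shows "linear_operator s s D (\<lambda>u. s c u - f u)"
proof -
  interpret s: banach_over s by fact
  show ?thesis
    using assms(2)
    by (auto simp: linear_operator_def s.scale_right_distrib s.scale_right_diff_distrib
        s.scale_left_commute)
qed

lemma linear_operator_on_kernel:
  assumes "banach_over s1" and "banach_over s2"
    and f: "linear_operator s1 s2 D f" and g: "linear_operator s1 s3 D g"
  shows "linear_operator s1 s3 (operator_kernel D f) g"
proof -
  interpret s1: banach_over s1 by fact
  interpret s2: banach_over s2 by fact
  have "s1.subspace (operator_kernel D f)"
    using linear_operatorD[OF assms(1) f] by (auto simp: s1.subspace_def operator_kernel_def)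
  then show ?thesis
    using g by (auto simp: linear_operator_def operator_kernel_def)
qed

lemma linear_the_inv_into:
  assumes "banach_over s1" and "banach_over s2"
    and f: "linear_operator s1 s2 D f" and bij: "bij_betw f D UNIV"
  shows "Vector_Spaces.linear s2 s1 (the_inv_into D f)"
proof -
  interpret s1: banach_over s1 by fact
  interpret s2: banach_over s2 by fact
  note fD = linear_operatorD[OF assms(1) f]
  let ?g = "the_inv_into D f"
  have inj: "inj_on f D" and g: "\<And>x. ?g x \<in> D" "\<And>x. f (?g x) = x"
    using bij the_inv_into_into[of f D _ D] f_the_inv_into_f[of f D] by (auto simp: bij_betw_def)
  have "?g (x + y) = ?g x + ?g y" for x y
    by (rule the_inv_into_f_eq[OF inj]) (simp_all add: g fD)
  moreover have "?g (s2 a x) = s1 a (?g x)" for a x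
    by (rule the_inv_into_f_eq[OF inj]) (simp_all add: g fD)
  ultimately show ?thesis
    unfolding Vector_Spaces.linear_iff
    using s1.vector_space_axioms s2.vector_space_axioms by blast
qed

section \<open>The Dirichlet operator\<close>

text \<open>
  Correcting a preimage \<open>v\<close> of \<open>x\<close> under \<open>g\<close> by the element of \<open>ker g\<close> with the same image under
  \<open>f\<close> moves it into \<open>ker f\<close> and does not change its image under \<open>g\<close>.
\<close>

lemma kernel_bijection_exchange:
  assumes "banach_over s1"
    and f: "linear_operator s1 s2 D f" and g: "linear_operator s1 s3 D g"
    and bij: "bij_betw f (operator_kernel D g) UNIV" and surj: "g ` D = UNIV"
  shows "bij_betw g (operator_kernel D f) UNIV"
proof -
  note fD = linear_operatorD[OF assms(1) f] and gD = linear_operatorD[OF assms(1) g]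
  have "inj_on g (operator_kernel D f)"
  proof (rule inj_onI)
    fix u v
    assume uv: "u \<in> operator_kernel D f" "v \<in> operator_kernel D f" "g u = g v"
    then have "u - v \<in> operator_kernel D g" "f (u - v) = 0"
      by (auto simp: operator_kernel_def fD gD)
    moreover have "0 \<in> operator_kernel D g" "f 0 = 0"
      by (simp_all add: operator_kernel_def fD gD)
    ultimately have "u - v = 0"
      using inj_onD[OF bij_betw_imp_inj_on[OF bij], of "u - v" 0] by simp
    then show "u = v" by simp
  qed
  moreover have "x \<in> g ` operator_kernel D f" for x
  proof -
    obtain v where v: "v \<in> D" "g v = x" using surj by (metis UNIV_I imageE)
    obtain w where "w \<in> operator_kernel D g" "f w = f v"
      using bij_betw_imp_surj_on[OF bij] by (metis UNIV_I imageE)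
    then have "v - w \<in> operator_kernel D f" "g (v - w) = x"
      using v by (auto simp: operator_kernel_def fD gD)
    then show ?thesis by blast
  qed
  ultimately show ?thesis by (auto simp: bij_betw_def)
qed

text \<open>The eigenspace is mapped into itself by \<open>f\<close>, which acts there as a scalar.\<close>

lemma eigenspace_subset_smooth_domain:
  assumes "banach_over s" and "linear_operator s s D f"
  shows "operator_kernel D (\<lambda>u. s c u - f u) \<subseteq> smooth_domain D f"
proof -
  interpret s: banach_over s by fact
  let ?K = "operator_kernel D (\<lambda>u. s c u - f u)"
  have invariant: "f u \<in> ?K" if "u \<in> ?K" for u
  proof -
    have "linear_operator s s ?K f"
      using linear_operator_on_kernel[OF assms(1,1) linear_operator_shifted[OF assms] assms(2)] .
    then have "s c u \<in> ?K" using that by (rule linear_operatorD(4)[OF assms(1)])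
    moreover have "s c u = f u" using that by (simp add: operator_kernel_def)
    ultimately show ?thesis by metis
  qed
  have "u \<in> power_domain D f k" if "u \<in> ?K" for u k
    using that
  proof (induction k arbitrary: u)
    case (Suc k)
    then show ?case using invariant[OF Suc.prems] by (auto simp: operator_kernel_def)
  qed simp
  then show ?thesis by (auto simp: smooth_domain_def)
qed

theorem lemma3p2:
  fixes sX :: "'k::real_normed_field \<Rightarrow> 'x::banach \<Rightarrow> 'x"
    and sY :: "'k \<Rightarrow> 'y::banach \<Rightarrow> 'y"
    and sB :: "'k \<Rightarrow> 'b::banach \<Rightarrow> 'b"
    and j :: "'y \<Rightarrow> 'x"
    and DA :: "'x set"
    and A :: "'x \<Rightarrow> 'x"
    and R :: "'x \<Rightarrow> 'b"
    and lam :: 'k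
  assumes "banach_over sX" and "banach_over sY" and "banach_over sB"
    and "continuous_embedding sY sX j"
    and "DA \<subseteq> range j"
    and "linear_operator sX sX DA A"
    and "linear_operator sX sB DA R"
    and "R ` DA = UNIV"
    and "closed_operator (j -` DA) (\<lambda>u. (A (j u), R (j u)))"
    and "generates_cosine sY sX j (operator_kernel DA R) A"
    and "lam \<in> resolvent_set sX (operator_kernel DA R) A"
  shows "bij_betw R (operator_kernel DA (\<lambda>u. sX lam u - A u)) UNIV
    \<and> (\<forall>(sZ :: 'k \<Rightarrow> 'z::banach \<Rightarrow> 'z) (i :: 'z \<Rightarrow> 'y).
          banach_over sZ \<and> continuous_embedding sZ sY i \<and>
          smooth_domain DA A \<subseteq> range (j \<circ> i) \<longrightarrow>
          (\<exists>S :: 'b \<Rightarrow> 'z. bounded_operator sB sZ S \<and>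
             (\<forall>x. j (i (S x)) = dirichlet_operator sX DA A R lam x)))"
proof -
  interpret sX: banach_over sX by fact
  let ?B = "\<lambda>u. sX lam u - A u"
  let ?K = "operator_kernel DA ?B"
  let ?D = "dirichlet_operator sX DA A R lam"
  note A = \<open>linear_operator sX sX DA A\<close> and R = \<open>linear_operator sX sB DA R\<close>
  have B: "linear_operator sX sX DA ?B" by (rule linear_operator_shifted) fact+
  have bij: "bij_betw R ?K UNIV"
    using \<open>lam \<in> resolvent_set sX (operator_kernel DA R) A\<close>
    by (intro kernel_bijection_exchange[OF \<open>banach_over sX\<close> B R _ \<open>R ` DA = UNIV\<close>])
      (simp add: resolvent_set_def)
  have D_lin: "Vector_Spaces.linear sB sX ?D"
    unfolding dirichlet_operator_def
    by (rule linear_the_inv_into[OF _ _ linear_operator_on_kernel[OF _ _ B R] bij]) fact+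
  have D_K: "?D x \<in> ?K" and R_D: "R (?D x) = x" for x
    using bij the_inv_into_into[of R ?K x ?K] f_the_inv_into_f[of R ?K x]
    by (auto simp: bij_betw_def dirichlet_operator_def)
  have D_unique: "?D x = u" if "u \<in> ?K" "R u = x" for u x
    unfolding dirichlet_operator_def
    by (rule the_inv_into_f_eq[OF bij_betw_imp_inj_on[OF bij]]) (fact that)+

  have "\<exists>S :: 'b \<Rightarrow> 'z. bounded_operator sB sZ S \<and> (\<forall>x. j (i (S x)) = ?D x)"
    if Z: "banach_over sZ" and i: "continuous_embedding sZ sY i"
      and smooth: "smooth_domain DA A \<subseteq> range (j \<circ> i)"
    for sZ :: "'k \<Rightarrow> 'z \<Rightarrow> 'z" and i :: "'z \<Rightarrow> 'y"
  proof -
    interpret sB: banach_over sB by fact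
    interpret sZ: banach_over sZ by fact
    note j = \<open>continuous_embedding sY sX j\<close>
    have cont_j: "bounded_linear j" and cont_i: "bounded_linear i"
      and inj: "inj (j \<circ> i)"
      using i j by (auto simp: continuous_embedding_def bounded_operator_def intro: inj_compose)
    have ji_add: "j (i (z + w)) = j (i z) + j (i w)"
      and ji_scale: "j (i (sZ a z)) = sX a (j (i z))" for z w a
      using i j
      by (simp_all add: continuous_embedding_def bounded_operator_def Vector_Spaces.linear_iff)
    have "?D x \<in> range (j \<circ> i)" for x
      using eigenspace_subset_smooth_domain[OF \<open>banach_over sX\<close> A] D_K smooth by blast
    then have "\<exists>z. j (i z) = ?D x" for x
      by (metis comp_apply imageE)
    then obtain S where S: "\<And>x. j (i (S x)) = ?D x" by metis
    have eqI: "z = w" if "j (i z) = j (i w)" for z w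
      using injD[OF inj] that by simp
    have "Vector_Spaces.linear sB sZ S"
      unfolding Vector_Spaces.linear_iff
    proof (intro conjI allI)
      show "S (x + y) = S x + S y" for x y
        by (rule eqI) (use D_lin in \<open>simp add: S ji_add Vector_Spaces.linear_iff\<close>)
      show "S (sB a x) = sZ a (S x)" for a x
        by (rule eqI) (use D_lin in \<open>simp add: S ji_scale Vector_Spaces.linear_iff\<close>)
    qed (fact sB.vector_space_axioms sZ.vector_space_axioms)+
    moreover have "closed (range (\<lambda>x. (x, S x)))"
      unfolding closed_sequential_limits
    proof (intro allI impI, elim conjE)
      fix p l
      assume p: "\<forall>n. p n \<in> range (\<lambda>x. (x, S x))" and "p \<longlonglongrightarrow> l"
      obtain x z where l: "l = (x, z)" by (cases l)
      define xs where "xs n = fst (p n)" for n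
      have "p n = (xs n, S (xs n))" for n
        using p by (metis (no_types, lifting) fst_conv imageE xs_def)
      then have "p = (\<lambda>n. (xs n, S (xs n)))" by blast
      then have x_lim: "xs \<longlonglongrightarrow> x" and z_lim: "(\<lambda>n. S (xs n)) \<longlonglongrightarrow> z"
        using tendsto_fst[OF \<open>p \<longlonglongrightarrow> l\<close>] tendsto_snd[OF \<open>p \<longlonglongrightarrow> l\<close>] by (simp_all add: l)
      have y_lim: "(\<lambda>n. i (S (xs n))) \<longlonglongrightarrow> i z"
        using z_lim by (rule bounded_linear.tendsto[OF cont_i])
      have D_lim: "(\<lambda>n. ?D (xs n)) \<longlonglongrightarrow> j (i z)"
        using bounded_linear.tendsto[OF cont_j y_lim] by (simp add: S)
      have AD: "A (?D y) = sX lam (?D y)" for y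
        using D_K[of y] by (simp add: operator_kernel_def)
      have lamD_lim: "(\<lambda>n. sX lam (?D (xs n))) \<longlonglongrightarrow> sX lam (j (i z))"
        by (rule sX.tendsto_scale[OF D_lim])
      \<comment> \<open>The operator \<open>u \<mapsto> (A u, R u)\<close> is closed with respect to the norm of \<open>Y\<close>, so the points are
        taken in \<open>Y\<close>, before applying \<open>j\<close>.\<close>
      let ?F = "\<lambda>u. (A (j u), R (j u))"
      have graph_lim: "(\<lambda>n. (i (S (xs n)), ?F (i (S (xs n))))) \<longlonglongrightarrow> (i z, (sX lam (j (i z)), x))"
        unfolding S AD R_D by (intro tendsto_Pair y_lim lamD_lim x_lim)
      have "(i (S (xs n)), ?F (i (S (xs n)))) \<in> operator_graph (j -` DA) ?F" for n
        using D_K[of "xs n"] by (auto simp: operator_graph_def operator_kernel_def S)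
      then have "(i z, (sX lam (j (i z)), x)) \<in> operator_graph (j -` DA) ?F"
        using closed_sequentially[OF _ _ graph_lim]
          \<open>closed_operator (j -` DA) ?F\<close>[unfolded closed_operator_def] by blast
      then have "j (i z) \<in> ?K" "R (j (i z)) = x"
        by (auto simp: operator_graph_def operator_kernel_def)
      then have "j (i z) = j (i (S x))"
        using D_unique S by metis
      then show "l \<in> range (\<lambda>x. (x, S x))"
        using eqI l by blast
    qed
    ultimately have "bounded_operator sB sZ S"
      by (rule bounded_operator_if_closed_graph[OF \<open>banach_over sB\<close> Z])
    then show ?thesis using S by blast
  qed
  with bij show ?thesis by blast
qed

end
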